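(* Let $d\ge1$, $n\ge1$ and $J\ge n+1$ be integers and $h>0$. Equip each axis $i=1,\dots,d$ of $\mathbb{R}^d$ with a uniform knot sequence of grid size $h$ carrying $J$ degree $n$ B-splines. Let $$Qf(\vec x)=\sum_{j\in\mathcal{J}}\left(\sum_{v\in W^d}W_v f(\vec\xi_{j+v})\right)b_j(\vec x)$$ be the degree $n$ quasi-interpolant of a positive function $f:\mathbb{R}^d\to\mathbb{R}$, where $\mathcal{J}=\{1,\dots,J\}^d$, $W=\{0,1,\dots,n\}$, $W_v=w_{v_1}w_{v_2}\cdots w_{v_d}$, $\vec\xi_j$ are the midpoints of the mesh cubes, and $b_j$ are the tensor product B-splines. Let $W^+=\{v\in W^d: W_v>0\}$. Let $M>0$ and $$K_M=\{g:\mathbb{R}^d\to\mathbb{R}: g(\vec\xi_i)\le g(\vec\xi_j)\exp(M|\vec\xi_i-\vec\xi_j|)\text{ for all }i,j\}.$$ Define $$E(h,n)=\begin{cases}\exp(Mh\sqrt d\,n)\left(1-\left(\sum_{v\in W^+}W_v\right)^{-1}\right)&\text{if }n\text{ is even},\\ \exp(Mh\sqrt d\,(n+1))\left(1-\left(\sum_{v\in W^+}W_v\right)^{-1}\right)&\text{if }n\text{ is odd}.\end{cases}$$ If $f\in K_M$ and $E(h,n)<1$, then $Qf(\vec x)>0$ for every $\vec x$ in the parameter hyperrectangle $D^n_\xi$.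
   Context: One-dimensional B-splines: for knots without repetition, $b^0_k(x)=1$ if $\xi_k\le x<\xi_{k+1}$ and $0$ otherwise, and for $n\ge1$ $$b^n_k=\gamma^n_k\, b^{n-1}_k+(1-\gamma^n_{k+1})\,b^{n-1}_{k+1},\qquad \gamma^n_k(x)=\frac{x-\xi_k}{\xi_{k+n}-\xi_k}.$$ The support of $b^n_k$ is $[\xi_k,\xi_{k+n+1}]$. On axis $i$ the knots are $\xi^{(i)}_1<\dots<\xi^{(i)}_{J+n+1}$ with constant spacing $h$, giving degree $n$ B-splines $b^{(i)}_1,\dots,b^{(i)}_J$ and parameter interval $[\xi^{(i)}_{n+1},\xi^{(i)}_{J+1}]$ (the maximal interval on which they form a partition of unity). Tensor products: for $j=(j_1,\dots,j_d)$, $b_j(\vec x)=\prod_{i=1}^d b^{(i)}_{j_i}(x_i)$, and $\vec\xi_j=(\xi^{(1)}_{j_1}+h/2,\dots,\xi^{(d)}_{j_d}+h/2)$ is the midpoint of the corresponding mesh cube. The parameter hyperrectangle is $D^n_\xi=\prod_{i=1}^d[\xi^{(i)}_{n+1},\xi^{(i)}_{J+1}]$. Weights: $w_0,\dots,w_n$ are the real numbers satisfying $$\sum_{v=0}^n w_v (v-j)^n=\prod_{i=1}^n\left(i-j-\tfrac12\right),\qquad j=0,1,\dots,n;$$ they satisfy $\sum_{v=0}^n w_v=1$ and $w_v=w_{n-v}$. $|\cdot|$ is the Euclidean norm. In the definition of $K_M$, the multi-indices $i,j$ range over all mesh cubes, i.e. over $\{1,\dots,J+n\}^d$. *)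

theory Defs
  imports "HOL-Analysis.Analysis"
begin

definition bspline_gamma :: "(nat \<Rightarrow> real) \<Rightarrow> nat \<Rightarrow> nat \<Rightarrow> real \<Rightarrow> real" where
  "bspline_gamma \<xi> n k x = (x - \<xi> k) / (\<xi> (k + n) - \<xi> k)"

text \<open>\<open>bspline \<xi> n k\<close> is the B-spline $b^n_k$ over the knot sequence \<open>\<xi>\<close>.\<close>

fun bspline :: "(nat \<Rightarrow> real) \<Rightarrow> nat \<Rightarrow> nat \<Rightarrow> real \<Rightarrow> real" where
  "bspline \<xi> 0 k x = (if \<xi> k \<le> x \<and> x < \<xi> (k + 1) then 1 else 0)"
| "bspline \<xi> (Suc n) k x =
     bspline_gamma \<xi> (Suc n) k x * bspline \<xi> n k x
     + (1 - bspline_gamma \<xi> (Suc n) (k + 1) x) * bspline \<xi> n (k + 1) x"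

text \<open>
  The axes of $R^d$ are the elements of a finite type \<open>'d\<close>, so $d$ is \<open>CARD('d)\<close> (hence $d \ge 1$),
  multi-indices are functions \<open>'d \<Rightarrow> nat\<close>, and \<open>\<xi> i k\<close> is the $k$-th knot on axis \<open>i\<close>.
  Only the knots with indices \<open>1, \<dots>, J + n + 1\<close> are meaningful.
\<close>

definition uniform_knots :: "nat \<Rightarrow> nat \<Rightarrow> real \<Rightarrow> ('d::finite \<Rightarrow> nat \<Rightarrow> real) \<Rightarrow> bool" where
  "uniform_knots n J h \<xi> \<longleftrightarrow> (\<forall>i. \<forall>k\<in>{1..J + n}. \<xi> i (k + 1) - \<xi> i k = h)"

definition multi_idx :: "nat set \<Rightarrow> ('d::finite \<Rightarrow> nat) set" where
  "multi_idx A = (UNIV \<rightarrow>\<^sub>E A)"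

definition tensor_bspline ::
    "('d::finite \<Rightarrow> nat \<Rightarrow> real) \<Rightarrow> nat \<Rightarrow> ('d \<Rightarrow> nat) \<Rightarrow> real ^ 'd \<Rightarrow> real" where
  "tensor_bspline \<xi> n j x = (\<Prod>i\<in>UNIV. bspline (\<xi> i) n (j i) (x $ i))"

definition cube_midpoint ::
    "('d::finite \<Rightarrow> nat \<Rightarrow> real) \<Rightarrow> real \<Rightarrow> ('d \<Rightarrow> nat) \<Rightarrow> real ^ 'd" where
  "cube_midpoint \<xi> h j = (\<chi> i. \<xi> i (j i) + h / 2)"

definition param_rectangle ::
    "('d::finite \<Rightarrow> nat \<Rightarrow> real) \<Rightarrow> nat \<Rightarrow> nat \<Rightarrow> (real ^ 'd) set" where
  "param_rectangle \<xi> n J = {x. \<forall>i. x $ i \<in> {\<xi> i (n + 1)..\<xi> i (J + 1)}}"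

text \<open>The linear system below determines \<open>w 0, \<dots>, w n\<close> uniquely.\<close>

definition quasi_weights :: "nat \<Rightarrow> (nat \<Rightarrow> real) \<Rightarrow> bool" where
  "quasi_weights n w \<longleftrightarrow>
     (\<forall>j\<in>{0..n}. (\<Sum>v=0..n. w v * (real v - real j) ^ n) = (\<Prod>i=1..n. real i - real j - 1 / 2))"

definition tensor_weight :: "(nat \<Rightarrow> real) \<Rightarrow> ('d::finite \<Rightarrow> nat) \<Rightarrow> real" where
  "tensor_weight w v = (\<Prod>i\<in>UNIV. w (v i))"

definition positive_weight_idx :: "nat \<Rightarrow> (nat \<Rightarrow> real) \<Rightarrow> ('d::finite \<Rightarrow> nat) set" where
  "positive_weight_idx n w = {v \<in> multi_idx {0..n}. tensor_weight w v > 0}"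

definition quasi_interpolant ::
    "('d::finite \<Rightarrow> nat \<Rightarrow> real) \<Rightarrow> real \<Rightarrow> nat \<Rightarrow> nat \<Rightarrow> (nat \<Rightarrow> real)
      \<Rightarrow> (real ^ 'd \<Rightarrow> real) \<Rightarrow> real ^ 'd \<Rightarrow> real" where
  "quasi_interpolant \<xi> h n J w f x =
     (\<Sum>j\<in>multi_idx {1..J}.
        (\<Sum>v\<in>multi_idx {0..n}. tensor_weight w v * f (cube_midpoint \<xi> h (\<lambda>i. j i + v i)))
        * tensor_bspline \<xi> n j x)"

definition K_class ::
    "('d::finite \<Rightarrow> nat \<Rightarrow> real) \<Rightarrow> real \<Rightarrow> nat \<Rightarrow> nat \<Rightarrow> real \<Rightarrow> (real ^ 'd \<Rightarrow> real) set" where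
  "K_class \<xi> h n J M =
     {g. \<forall>i\<in>multi_idx {1..J + n}. \<forall>j\<in>multi_idx {1..J + n}.
           g (cube_midpoint \<xi> h i)
             \<le> g (cube_midpoint \<xi> h j) * exp (M * norm (cube_midpoint \<xi> h i - cube_midpoint \<xi> h j))}"

text \<open>$E(h,n)$; the type argument supplies the dimension.\<close>

definition E_bound :: "'d::finite itself \<Rightarrow> real \<Rightarrow> (nat \<Rightarrow> real) \<Rightarrow> real \<Rightarrow> nat \<Rightarrow> real" where
  "E_bound (_ :: 'd itself) M w h n =
     (let S = (\<Sum>v\<in>(positive_weight_idx n w :: ('d \<Rightarrow> nat) set). tensor_weight w v) in
      if even n then exp (M * h * sqrt (real CARD('d)) * real n) * (1 - inverse S)
      else exp (M * h * sqrt (real CARD('d)) * (real n + 1)) * (1 - inverse S))"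

end

theory Submission
  imports Defs
begin

text \<open>
  The B-splines are nonnegative, and at every point of the parameter hyperrectangle at least one
  of them is strictly positive. Hence it suffices that every coefficient
  $\sum_v W_v f(\vec\xi_{j+v})$ of the quasi-interpolant is positive.

  The points $\vec\xi_{j+v}$ that enter one coefficient lie pairwise within distance
  $h \sqrt d\, n$, so for $f \in K_M$ the ratio of two of the values $f(\vec\xi_{j+v})$ is at most
  $r = \exp (M h \sqrt d\, n)$. Let $m$ be the smallest of these values and $S$ the sum of the
  positive weights. The weights sum to $1$, so the others sum to $1 - S$, and the coefficient is
  at least $m S - m r (S - 1) = m S (1 - r (1 - 1/S))$. Since $S \ge 1$, we have
  $r (1 - 1/S) \le E(h,n) < 1$ for either parity of $n$, and the coefficient is positive.

  That the weights sum to $1$ is read off from their linear system: both sides are polynomials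
  of degree $n$ in $j$ that agree at the $n+1$ points $0, \dots, n$, so their leading coefficients
  agree.
\<close>

section \<open>Positivity of B-splines\<close>

lemma bspline_eq_0_left:
  assumes "strict_mono_on {k..k + n + 1} \<xi>" and "x < \<xi> k"
  shows "bspline \<xi> n k x = 0"
  using assms
proof (induction n arbitrary: k)
  case (Suc n)
  have "\<xi> k < \<xi> (k + 1)"
    using Suc.prems(1) by (auto intro: strict_mono_onD)
  moreover have "strict_mono_on {k..k + n + 1} \<xi>" "strict_mono_on {k + 1..k + 1 + n + 1} \<xi>"
    by (rule monotone_on_subset[OF Suc.prems(1)], auto)+
  ultimately show ?case
    using Suc.IH[of k] Suc.IH[of "k + 1"] Suc.prems(2) by simp
qed simp

lemma bspline_eq_0_right:
  assumes "strict_mono_on {k..k + n + 1} \<xi>" and "\<xi> (k + n + 1) \<le> x"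
  shows "bspline \<xi> n k x = 0"
  using assms
proof (induction n arbitrary: k)
  case (Suc n)
  have "\<xi> (k + n + 1) < \<xi> (k + Suc n + 1)"
    using Suc.prems(1) by (auto intro: strict_mono_onD)
  moreover have "strict_mono_on {k..k + n + 1} \<xi>" "strict_mono_on {k + 1..k + 1 + n + 1} \<xi>"
    by (rule monotone_on_subset[OF Suc.prems(1)], auto)+
  ultimately show ?case
    using Suc.IH[of k] Suc.IH[of "k + 1"] Suc.prems(2) by simp
qed simp

text \<open>
  Outside the support of \<open>bspline \<xi> n k\<close> the factor $\gamma^{n+1}_k$ in the recursion may be
  negative or exceed $1$, but there the B-spline that it multiplies vanishes.
\<close>

lemma bspline_recursion_terms_nonneg:
  assumes mono: "strict_mono_on {k..k + n + 1} \<xi>" and nonneg: "0 \<le> bspline \<xi> n k x"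
  shows "0 \<le> bspline_gamma \<xi> (Suc n) k x * bspline \<xi> n k x"
    and "0 \<le> (1 - bspline_gamma \<xi> (Suc n) k x) * bspline \<xi> n k x"
proof -
  have less: "\<xi> k < \<xi> (k + n + 1)"
    using mono by (auto intro: strict_mono_onD)
  have "0 \<le> bspline_gamma \<xi> (Suc n) k x \<and> bspline_gamma \<xi> (Suc n) k x \<le> 1"
    if "\<xi> k \<le> x" "x < \<xi> (k + n + 1)"
    using that less by (simp add: bspline_gamma_def)
  then show "0 \<le> bspline_gamma \<xi> (Suc n) k x * bspline \<xi> n k x"
    and "0 \<le> (1 - bspline_gamma \<xi> (Suc n) k x) * bspline \<xi> n k x"
    using nonneg bspline_eq_0_left[OF mono, of x] bspline_eq_0_right[OF mono, of x]
    by (cases "\<xi> k \<le> x"; cases "x < \<xi> (k + n + 1)"; simp)+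
qed

lemma bspline_nonneg:
  assumes "strict_mono_on {k..k + n + 1} \<xi>"
  shows "0 \<le> bspline \<xi> n k x"
  using assms
proof (induction n arbitrary: k)
  case (Suc n)
  have "strict_mono_on {k..k + n + 1} \<xi>" "strict_mono_on {k + 1..k + 1 + n + 1} \<xi>"
    by (rule monotone_on_subset[OF Suc.prems], auto)+
  then show ?case
    using bspline_recursion_terms_nonneg Suc.IH by (simp del: One_nat_def)
qed simp

text \<open>
  The two B-splines of lower degree in the recursion have overlapping supports, so that one of
  them is positive at \<open>x\<close>. The exception is degree $1$ at the middle knot, where the open
  supports only touch; there the value of the right-hand piecewise constant is $1$.
\<close>

lemma bspline_pos:
  assumes "strict_mono_on {k..k + n + 1} \<xi>" and "\<xi> k < x" and "x < \<xi> (k + n + 1)"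
  shows "0 < bspline \<xi> n k x"
  using assms
proof (induction n arbitrary: k)
  case (Suc n)
  have less: "\<xi> a < \<xi> b" if "k \<le> a" "a < b" "b \<le> k + Suc n + 1" for a b
    using Suc.prems(1) that by (auto intro: strict_mono_onD)
  have mono: "strict_mono_on {k..k + n + 1} \<xi>" "strict_mono_on {k + 1..k + 1 + n + 1} \<xi>"
    by (rule monotone_on_subset[OF Suc.prems(1)], auto)+
  have left: "0 \<le> bspline_gamma \<xi> (Suc n) k x * bspline \<xi> n k x"
    using bspline_recursion_terms_nonneg(1) bspline_nonneg mono(1) by blast
  have right: "0 \<le> (1 - bspline_gamma \<xi> (Suc n) (k + 1) x) * bspline \<xi> n (k + 1) x"
    using bspline_recursion_terms_nonneg(2) bspline_nonneg mono(2) by blast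
  have "0 < bspline_gamma \<xi> (Suc n) k x * bspline \<xi> n k x \<or>
        0 < (1 - bspline_gamma \<xi> (Suc n) (k + 1) x) * bspline \<xi> n (k + 1) x"
  proof (cases "x < \<xi> (k + n + 1)")
    case True
    have "0 < bspline_gamma \<xi> (Suc n) k x"
      using Suc.prems(2) less[of k "k + Suc n"] by (simp add: bspline_gamma_def)
    then show ?thesis
      using Suc.IH[OF mono(1) Suc.prems(2) True] by simp
  next
    case False
    have "bspline_gamma \<xi> (Suc n) (k + 1) x < 1"
      using Suc.prems(3) less[of "k + 1" "k + Suc n + 1"] by (simp add: bspline_gamma_def)
    moreover have "0 < bspline \<xi> n (k + 1) x"
    proof (cases "n = 0")
      case True
      then show ?thesis
        using False Suc.prems(3) by simp
    next
      case n: False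
      have "\<xi> (k + 1) < x"
        using False less[of "k + 1" "k + n + 1"] n by simp
      then show ?thesis
        using Suc.IH[OF mono(2)] Suc.prems(3) by simp
    qed
    ultimately show ?thesis
      by simp
  qed
  then show ?case
    using left right by (auto simp del: One_nat_def)
qed simp

text \<open>
  If \<open>x\<close> lies in the mesh interval starting at \<open>\<xi> m\<close>, the B-spline with index \<open>m\<close> vanishes at
  the knot \<open>\<xi> m\<close> itself, whereas the one with index \<open>m - 1\<close> is positive on the whole half-open
  interval. This choice also covers the right end point $\xi_{J+1}$ of the parameter interval.
\<close>

lemma ex_bspline_pos:
  assumes mono: "strict_mono_on {1..J + n + 1} \<xi>" and n: "1 \<le> n" and nJ: "n \<le> J"
    and x: "\<xi> (n + 1) \<le> x" "x \<le> \<xi> (J + 1)"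
  shows "\<exists>k\<in>{1..J}. 0 < bspline \<xi> n k x"
proof -
  have less: "\<xi> a < \<xi> b" if "1 \<le> a" "a < b" "b \<le> J + n + 1" for a b
    using mono that by (auto intro: strict_mono_onD)
  define m where "m = Max {a \<in> {1..J + 1}. \<xi> a \<le> x}"
  have in_set: "n + 1 \<in> {a \<in> {1..J + 1}. \<xi> a \<le> x}"
    using x nJ by simp
  have m: "m \<in> {a \<in> {1..J + 1}. \<xi> a \<le> x}"
    unfolding m_def by (rule Max_in) (use in_set in auto)
  have m_ge: "n + 1 \<le> m"
    unfolding m_def by (rule Max_ge[OF _ in_set]) simp
  have "x < \<xi> (m + 1)"
  proof (cases "m = J + 1")
    case True
    then show ?thesis
      using x(2) less[of "J + 1" "J + 2"] n by simp
  next
    case False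
    show ?thesis
    proof (rule ccontr)
      assume "\<not> x < \<xi> (m + 1)"
      then have "m + 1 \<in> {a \<in> {1..J + 1}. \<xi> a \<le> x}"
        using m False by auto
      then have "m + 1 \<le> m"
        by (subst (2) m_def) (rule Max_ge, auto)
      then show False
        by simp
    qed
  qed
  also have "\<xi> (m + 1) \<le> \<xi> (m - 1 + n + 1)"
    using less[of "m + 1" "m - 1 + n + 1"] m m_ge n by (cases "n = 1") auto
  finally have right: "x < \<xi> (m - 1 + n + 1)" .
  have left: "\<xi> (m - 1) < x"
    using less[of "m - 1" m] m m_ge n by fastforce
  have "0 < bspline \<xi> n (m - 1) x"
  proof (rule bspline_pos)
    show "strict_mono_on {m - 1..m - 1 + n + 1} \<xi>"
      using m m_ge n by (intro monotone_on_subset[OF mono]) auto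
  qed (use left right in auto)
  then show ?thesis
    using m m_ge n by (intro bexI[of _ "m - 1"]) auto
qed

section \<open>Weights\<close>

lemma coeff_prod_linear_top:
  fixes a :: "nat \<Rightarrow> real"
  shows "degree (\<Prod>i=1..n. [:- a i, 1:]) = n \<and> coeff (\<Prod>i=1..n. [:- a i, 1:]) n = 1"
proof -
  have "degree (\<Prod>i=1..n. [:- a i, 1:]) = n"
    by (subst degree_prod_eq_sum_degree) auto
  moreover have "lead_coeff (\<Prod>i=1..n. [:- a i, 1:]) = 1"
    by (simp add: lead_coeff_prod)
  ultimately show ?thesis
    by simp
qed

lemma sum_quasi_weights:
  assumes "quasi_weights n w"
  shows "(\<Sum>v=0..n. w v) = 1"
proof -
  \<comment> \<open>The sign $(-1)^n$ common to both sides of the linear system is dropped, so that the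
    factors are monic in $j$.\<close>
  define p where "p = (\<Sum>v=0..n. smult (w v) ([:- real v, 1:] ^ n))"
  define q where "q = (\<Prod>i=1..n. [:- (real i - 1 / 2), 1:])"
  have q: "degree q = n" "coeff q n = 1"
    unfolding q_def using coeff_prod_linear_top[where a = "\<lambda>i. real i - 1 / 2"] by auto
  have coeff_power: "coeff ([:- real v, 1:] ^ n) n = 1" for v
    using coeff_prod_linear_top[where a = "\<lambda>_. real v" and n = n] by simp
  have "poly p (real j) = poly q (real j)" if "j \<in> {0..n}" for j
  proof -
    have "poly p (real j) = (\<Sum>v=0..n. w v * (real j - real v) ^ n)"
      by (simp add: p_def poly_sum)
    also have "\<dots> = (-1) ^ n * (\<Sum>v=0..n. w v * (real v - real j) ^ n)"
      unfolding sum_distrib_left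
      by (intro sum.cong refl) (simp flip: power_mult_distrib)
    also have "\<dots> = (-1) ^ n * (\<Prod>i=1..n. real i - real j - 1 / 2)"
      using assms that by (simp add: quasi_weights_def)
    also have "\<dots> = (\<Prod>i=1..n. - 1 * (real i - real j - 1 / 2))"
      by (simp only: prod.distrib prod_constant card_atLeastAtMost add_diff_cancel_right' Suc_eq_plus1)
    also have "\<dots> = poly q (real j)"
      by (simp add: q_def poly_prod algebra_simps)
    finally show ?thesis .
  qed
  moreover have "degree p \<le> n"
    unfolding p_def by (intro degree_sum_le) (auto intro!: order.trans[OF degree_smult_le] simp: degree_linear_power)
  ultimately have "p = q"
    using q(1) by (intro poly_eqI_degree[where A = "real ` {0..n}"]) (auto simp: card_image)
  moreover have "coeff p n = (\<Sum>v=0..n. w v)"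
    by (simp add: p_def coeff_sum coeff_power)
  ultimately show ?thesis
    using q(2) by simp
qed

lemma sum_tensor_weight:
  assumes "quasi_weights n w"
  shows "(\<Sum>v\<in>(multi_idx {0..n} :: ('d::finite \<Rightarrow> nat) set). tensor_weight w v) = 1"
proof -
  have "(\<Sum>v\<in>(multi_idx {0..n} :: ('d \<Rightarrow> nat) set). tensor_weight w v) = (\<Prod>i\<in>(UNIV :: 'd set). \<Sum>a=0..n. w a)"
    unfolding multi_idx_def tensor_weight_def by (subst prod_sum_PiE) auto
  then show ?thesis
    using sum_quasi_weights[OF assms] by simp
qed

lemma finite_multi_idx: "finite A \<Longrightarrow> finite (multi_idx A :: ('d::finite \<Rightarrow> nat) set)"
  unfolding multi_idx_def by (intro finite_PiE) auto

lemma sum_positive_part_ge: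
  fixes W :: "'a \<Rightarrow> real"
  assumes "finite A"
  shows "sum W A \<le> sum W {v \<in> A. 0 < W v}"
proof -
  have "sum W A = sum W {v \<in> A. 0 < W v} + sum W (A - {v \<in> A. 0 < W v})"
    using assms by (subst sum.subset_diff[of "{v \<in> A. 0 < W v}" A W]) auto
  moreover have "sum W (A - {v \<in> A. 0 < W v}) \<le> 0"
    by (rule sum_nonpos) auto
  ultimately show ?thesis
    by simp
qed

text \<open>
  The smallest value bounds the terms of positive weight from below, and \<open>r\<close> times the smallest
  value bounds the size of the other terms.
\<close>

lemma signed_weighted_sum_pos:
  fixes W F :: "'a \<Rightarrow> real"
  assumes A: "finite A" and W: "sum W A = 1"
    and pos: "\<And>v. v \<in> A \<Longrightarrow> 0 < F v"
    and ratio: "\<And>u v. u \<in> A \<Longrightarrow> v \<in> A \<Longrightarrow> F u \<le> F v * r"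
    and r: "r * (1 - inverse (sum W {v \<in> A. 0 < W v})) < 1"
  shows "0 < (\<Sum>v\<in>A. W v * F v)"
proof -
  let ?P = "{v \<in> A. 0 < W v}"
  define S where "S = sum W ?P"
  have S: "1 \<le> S"
    using sum_positive_part_ge[OF A, of W] W by (simp add: S_def)
  have "A \<noteq> {}"
    using W by auto
  then obtain u where u: "u \<in> A" and u_min: "\<And>v. v \<in> A \<Longrightarrow> F u \<le> F v"
    using arg_min_if_finite(1)[OF A] arg_min_least[OF A] by metis
  have split: "sum g A = sum g ?P + sum g (A - ?P)" for g :: "'a \<Rightarrow> real"
    using A by (subst sum.subset_diff[of ?P A g]) auto
  have rest: "sum W (A - ?P) = 1 - S"
    using split[of W] W by (simp add: S_def)
  have "r * (S - 1) < S"
    using r S by (simp add: S_def[symmetric] field_simps)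
  then have "0 < S + r * (1 - S)"
    by (simp add: algebra_simps)
  then have "0 < F u * (S + r * (1 - S))"
    using pos[OF u] by (rule mult_pos_pos[rotated])
  also have "F u * (S + r * (1 - S)) = (\<Sum>v\<in>?P. W v * F u) + (\<Sum>v\<in>A - ?P. W v * (F u * r))"
    unfolding sum_distrib_right[symmetric] S_def[symmetric] rest by (simp add: algebra_simps)
  also have "\<dots> \<le> (\<Sum>v\<in>?P. W v * F v) + (\<Sum>v\<in>A - ?P. W v * F v)"
    using u u_min ratio
    by (intro add_mono sum_mono) (auto intro!: mult_left_mono mult_left_mono_neg)
  also have "\<dots> = (\<Sum>v\<in>A. W v * F v)"
    by (rule split[symmetric])
  finally show ?thesis .
qed

section \<open>Uniform knots\<close>

lemma uniform_knots_eq: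
  assumes "uniform_knots n J h \<xi>" and "k \<in> {1..J + n + 1}"
  shows "\<xi> i k = \<xi> i 1 + (real k - 1) * h"
  using assms(2)
proof (induction k)
  case (Suc k)
  show ?case
  proof (cases "k = 0")
    case False
    then have "\<xi> i (k + 1) - \<xi> i k = h"
      using assms(1) Suc.prems by (auto simp: uniform_knots_def)
    then show ?thesis
      using Suc False by (simp add: algebra_simps)
  qed simp
qed simp

lemma strict_mono_uniform_knots:
  assumes "uniform_knots n J h \<xi>" and "0 < h"
  shows "strict_mono_on {1..J + n + 1} (\<xi> i)"
proof (rule strict_mono_onI)
  fix a b
  assume "a \<in> {1..J + n + 1}" "b \<in> {1..J + n + 1}" "a < b"
  then show "\<xi> i a < \<xi> i b"
    using assms by (simp add: uniform_knots_eq[OF assms(1), of a] uniform_knots_eq[OF assms(1), of b])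
qed

lemma norm_le_sqrt_card_times_bound:
  fixes x :: "real ^ 'd::finite"
  assumes "\<And>i. \<bar>x $ i\<bar> \<le> c"
  shows "norm x \<le> sqrt (real CARD('d)) * c"
proof -
  have "0 \<le> c"
    using assms[of undefined] by linarith
  have "(\<Sum>i\<in>UNIV. (norm (x $ i))\<^sup>2) \<le> (\<Sum>i\<in>(UNIV :: 'd set). c\<^sup>2)"
    using assms by (intro sum_mono power_mono) auto
  then have "norm x \<le> sqrt (real CARD('d) * c\<^sup>2)"
    by (simp add: norm_vec_def L2_set_def)
  then show ?thesis
    using \<open>0 \<le> c\<close> by (simp add: real_sqrt_mult)
qed

lemma norm_cube_midpoint_diff_le:
  fixes \<xi> :: "'d::finite \<Rightarrow> nat \<Rightarrow> real"
  assumes knots: "uniform_knots n J h \<xi>" and h: "0 < h"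
    and j: "j \<in> multi_idx {1..J}" and u: "u \<in> multi_idx {0..n}" and v: "v \<in> multi_idx {0..n}"
  shows "norm (cube_midpoint \<xi> h (\<lambda>i. j i + u i) - cube_midpoint \<xi> h (\<lambda>i. j i + v i))
    \<le> sqrt (real CARD('d)) * (h * real n)"
proof (rule norm_le_sqrt_card_times_bound)
  fix i
  have range: "j i \<in> {1..J}" "u i \<in> {0..n}" "v i \<in> {0..n}"
    using j u v by (auto simp: multi_idx_def PiE_iff)
  then have "\<xi> i (j i + u i) - \<xi> i (j i + v i) = (real (u i) - real (v i)) * h"
    by (subst (1 2) uniform_knots_eq[OF knots]) (auto simp: algebra_simps)
  moreover have "\<bar>real (u i) - real (v i)\<bar> * h \<le> real n * h"
    using range h by (intro mult_right_mono) auto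
  ultimately show "\<bar>(cube_midpoint \<xi> h (\<lambda>i. j i + u i) - cube_midpoint \<xi> h (\<lambda>i. j i + v i)) $ i\<bar> \<le> h * real n"
    using h by (simp add: cube_midpoint_def abs_mult mult.commute)
qed

section \<open>Positivity of the quasi-interpolant\<close>

text \<open>
  For odd \<open>n\<close> the exponent in $E(h,n)$ is larger, and the common factor $1 - 1/S$ is nonnegative
  because $S \ge 1$; so a single bound serves both parities.
\<close>

lemma exp_mult_positive_weight_le_E_bound:
  assumes "quasi_weights n w" and "0 < h" and "0 < M"
  shows "exp (M * h * sqrt (real CARD('d::finite)) * real n)
      * (1 - inverse (\<Sum>v\<in>(positive_weight_idx n w :: ('d \<Rightarrow> nat) set). tensor_weight w v))
    \<le> E_bound TYPE('d) M w h n"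
proof -
  define S where "S = (\<Sum>v\<in>(positive_weight_idx n w :: ('d \<Rightarrow> nat) set). tensor_weight w v)"
  have "1 \<le> S"
    using sum_positive_part_ge[of "multi_idx {0..n} :: ('d \<Rightarrow> nat) set" "tensor_weight w"]
      sum_tensor_weight[OF assms(1), where 'd = 'd] finite_multi_idx[of "{0..n}"]
    by (simp add: S_def positive_weight_idx_def)
  then have "0 \<le> 1 - inverse S"
    by (simp add: inverse_le_1_iff)
  moreover have "exp (M * h * sqrt (real CARD('d)) * real n) \<le> exp (M * h * sqrt (real CARD('d)) * (real n + 1))"
    using assms by (simp add: algebra_simps)
  ultimately show ?thesis
    unfolding E_bound_def Let_def S_def[symmetric] by (auto intro: mult_right_mono)
qed

lemma quasi_interpolant_coefficient_pos:
  fixes \<xi> :: "'d::finite \<Rightarrow> nat \<Rightarrow> real" and f :: "real ^ 'd \<Rightarrow> real"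
  assumes h: "0 < h" and M: "0 < M" and knots: "uniform_knots n J h \<xi>"
    and w: "quasi_weights n w" and f_pos: "\<And>x. 0 < f x" and K: "f \<in> K_class \<xi> h n J M"
    and E: "E_bound TYPE('d) M w h n < 1" and j: "j \<in> multi_idx {1..J}"
  shows "0 < (\<Sum>v\<in>multi_idx {0..n}. tensor_weight w v * f (cube_midpoint \<xi> h (\<lambda>i. j i + v i)))"
proof (rule signed_weighted_sum_pos[where r = "exp (M * h * sqrt (real CARD('d)) * real n)"])
  show "exp (M * h * sqrt (real CARD('d)) * real n)
      * (1 - inverse (sum (tensor_weight w) {v \<in> multi_idx {0..n} :: ('d \<Rightarrow> nat) set. 0 < tensor_weight w v})) < 1"
    using exp_mult_positive_weight_le_E_bound[OF w h M, where 'd = 'd] E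
    by (simp add: positive_weight_idx_def)
next
  fix u v :: "'d \<Rightarrow> nat"
  assume uv: "u \<in> multi_idx {0..n}" "v \<in> multi_idx {0..n}"
  let ?x = "\<lambda>v. cube_midpoint \<xi> h (\<lambda>i. j i + v i)"
  have idx: "(\<lambda>i. j i + v i) \<in> multi_idx {1..J + n}" if "v \<in> multi_idx {0..n}" for v
    using j that by (fastforce simp: multi_idx_def PiE_iff intro: add_mono trans_le_add1)
  have "f (?x u) \<le> f (?x v) * exp (M * norm (?x u - ?x v))"
    using K idx[OF uv(1)] idx[OF uv(2)] by (simp add: K_class_def)
  also have "\<dots> \<le> f (?x v) * exp (M * h * sqrt (real CARD('d)) * real n)"
    using mult_left_mono[OF norm_cube_midpoint_diff_le[OF knots h j uv], of M] M
    by (intro mult_left_mono less_imp_le[OF f_pos]) (simp add: mult_ac)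
  finally show "f (?x u) \<le> f (?x v) * exp (M * h * sqrt (real CARD('d)) * real n)" .
qed (use f_pos sum_tensor_weight[OF w] finite_multi_idx in auto)

theorem theorem3p3:
  fixes n J :: nat and h M :: real
    and \<xi> :: "'d::finite \<Rightarrow> nat \<Rightarrow> real"
    and w :: "nat \<Rightarrow> real"
    and f :: "real ^ 'd \<Rightarrow> real"
  assumes "n \<ge> 1" and "J \<ge> n + 1" and "h > 0" and "M > 0"
    and "uniform_knots n J h \<xi>"
    and "quasi_weights n w"
    and "\<And>x. f x > 0"
    and "f \<in> K_class \<xi> h n J M"
    and "E_bound TYPE('d) M w h n < 1"
  shows "\<forall>x\<in>param_rectangle \<xi> n J. quasi_interpolant \<xi> h n J w f x > 0"
proof
  fix x
  assume x: "x \<in> param_rectangle \<xi> n J"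
  have mono: "strict_mono_on {1..J + n + 1} (\<xi> i)" for i
    using strict_mono_uniform_knots[OF assms(5,3)] .
  have "\<forall>i. \<exists>k\<in>{1..J}. 0 < bspline (\<xi> i) n k (x $ i)"
    using ex_bspline_pos[OF mono \<open>n \<ge> 1\<close>] x assms(2) by (auto simp: param_rectangle_def)
  then obtain k where k: "\<And>i. k i \<in> {1..J}" "\<And>i. 0 < bspline (\<xi> i) n (k i) (x $ i)"
    by metis
  have k_idx: "k \<in> multi_idx {1..J}"
    using k(1) by (simp add: multi_idx_def PiE_iff)
  have k_pos: "0 < tensor_bspline \<xi> n k x"
    unfolding tensor_bspline_def by (intro prod_pos) (auto intro: k(2))
  have nonneg: "0 \<le> tensor_bspline \<xi> n j x" if "j \<in> multi_idx {1..J}" for j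
    unfolding tensor_bspline_def
  proof (intro prod_nonneg ballI bspline_nonneg)
    fix i
    have "j i \<in> {1..J}"
      using that by (auto simp: multi_idx_def PiE_iff)
    then show "strict_mono_on {j i..j i + n + 1} (\<xi> i)"
      by (intro monotone_on_subset[OF mono]) auto
  qed
  note coefficient_pos = quasi_interpolant_coefficient_pos[OF assms(3-)]
  show "0 < quasi_interpolant \<xi> h n J w f x"
    unfolding quasi_interpolant_def
  proof (rule sum_pos2[OF _ k_idx])
    show "finite (multi_idx {1..J} :: ('d \<Rightarrow> nat) set)"
      by (simp add: finite_multi_idx)
  qed (use coefficient_pos k_idx k_pos nonneg in \<open>auto intro!: mult_nonneg_nonneg less_imp_le[OF coefficient_pos]\<close>)
qed

end
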